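(* In the setting described in the context, let $\theta\in[1,2]$, $\theta_*=\frac{\theta}{2-\theta}$ ($=\infty$ if $\theta=2$), and $\delta>0$. Let $\zeta\in\mathbf R^\nu$ and $U,S\in\mathbf S^n$ be such that $$\left[\begin{array}{cc}U+S&B^T\\ B&\mathrm{Diag}\{\zeta\}\end{array}\right]\succeq0,\qquad\|\zeta\|_{\theta_*}\le1.$$ Let also $H_1\in\mathbf R^{m\times\mu_1}$ and $H_2\in\mathbf R^{m\times\mu_2}$ be $\delta$-admissible contrast matrices. Then $$\mathcal R^2[[H_1,H_2]]=\max_x\left\{\|Bx\|_\theta^2:\ x\in X_{\rm s},\ \|[H_1,H_2]^TAx\|_\infty\le1\right\}\le\mathcal R[U|\widetilde X,H_1]+\mathcal R[S|X_{\rm s},H_2].$$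
   Context: $\mathbf S^k$ is the space of symmetric $k\times k$ real matrices, $\mathbf S^k_+$ its positive semidefinite cone. $A\in\mathbf R^{m\times n}$, $B\in\mathbf R^{\nu\times n}$. $X\subset\mathbf R^n$ is a nonempty convex compact set whose symmetrization $X_{\rm s}=\frac12(X-X)$ is contained in the intersection $\widetilde X\cap\overline X$, where $$\widetilde X=\{x\in\mathbf R^n:\exists z\in\mathbf R^N,\ t\in\mathcal T:\ x=Pz,\ z^TT_kz\le t_k,\ k\le K\}$$ is an ellitope ($T_k\in\mathbf S^N_+$, $\sum_kT_k\succ0$, $\mathcal T\subset\mathbf R^K_+$ convex, compact, with nonempty interior, and monotone: $0\le t'\le t\in\mathcal T$ implies $t'\in\mathcal T$), and $\overline X=\{x\in\mathbf R^n:\exists w\in\mathbf R^q: x=Rw,\ Qw\in\mathrm{Conv}\{\pm v_1,\dots,\pm v_J\}\}$ with $R\in\mathbf R^{n\times q}$, $Q\in\mathbf R^{p\times q}$ having trivial kernel, $v_j\in\mathbf R^p$. For each $\delta>0$ a norm $\pi_\delta$ on $\mathbf R^m$ is given; a matrix with $m$ rows is $\delta$-admissible if the $\pi_\delta$-norms of its columns do not exceed 1. (The unit ball of $\pi_\delta$ is assumed to be an ellitope, and $\pi_\delta(h)\le1$ implies $\mathrm{Prob}_{\xi\sim P_x}\{|h^T\xi|>1\}\le\delta$ for all $x\in X$, where $P_x$ is the distribution of the noise $\xi_x$ in the observation $\omega=Ax+\xi_x$.) For a contrast matrix $H\in\mathbf R^{m\times\mu}$, $$\mathcal R[H]=\max_x\{\|Bx\|_\theta:\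 x\in X_{\rm s},\ \|H^TAx\|_\infty\le1\},$$ and for $V\in\mathbf S^n$, a convex compact set $\Xi\subset\mathbf R^n$ and a matrix $G$ with $m$ rows, $$\mathcal R[V|\Xi,G]=\max_x\{x^TVx:\ x\in\Xi,\ \|G^TAx\|_\infty\le1\}.$$ *)

theory Defs
  imports "HOL-Probability.Probability_Measure"
begin

definition symmetric :: "real^'n^'n \<Rightarrow> bool" where
  "symmetric M \<longleftrightarrow> transpose M = M"

definition psd :: "real^'n^'n \<Rightarrow> bool" where
  "psd M \<longleftrightarrow> symmetric M \<and> (\<forall>x. 0 \<le> x \<bullet> (M *v x))"

definition pd :: "real^'n^'n \<Rightarrow> bool" where
  "pd M \<longleftrightarrow> symmetric M \<and> (\<forall>x. x \<noteq> 0 \<longrightarrow> 0 < x \<bullet> (M *v x))"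

definition Diag :: "real^'n \<Rightarrow> real^'n^'n" where
  "Diag z = (\<chi> i j. if i = j then z $ i else 0)"

definition block_matrix ::
  "real^'a^'c \<Rightarrow> real^'b^'c \<Rightarrow> real^'a^'d \<Rightarrow> real^'b^'d \<Rightarrow> real^('a + 'b)^('c + 'd)" where
  "block_matrix M11 M12 M21 M22 = (\<chi> i j.
     case i of
       Inl r \<Rightarrow> (case j of Inl s \<Rightarrow> M11 $ r $ s | Inr s \<Rightarrow> M12 $ r $ s)
     | Inr r \<Rightarrow> (case j of Inl s \<Rightarrow> M21 $ r $ s | Inr s \<Rightarrow> M22 $ r $ s))"

definition hcat :: "real^'a^'m \<Rightarrow> real^'b^'m \<Rightarrow> real^('a + 'b)^'m" where
  "hcat G H = (\<chi> i j. case j of Inl a \<Rightarrow> G $ i $ a | Inr b \<Rightarrow> H $ i $ b)"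

definition lp_norm :: "ereal \<Rightarrow> real^'n \<Rightarrow> real" where
  "lp_norm p x =
     (if p = \<infinity> then infnorm x
      else (\<Sum>i\<in>UNIV. \<bar>x $ i\<bar> powr real_of_ereal p) powr (1 / real_of_ereal p))"

definition theta_star :: "real \<Rightarrow> ereal" where
  "theta_star \<theta> = (if \<theta> = 2 then \<infinity> else ereal (\<theta> / (2 - \<theta>)))"

definition is_norm :: "('a::real_vector \<Rightarrow> real) \<Rightarrow> bool" where
  "is_norm f \<longleftrightarrow>
     (\<forall>x. 0 \<le> f x) \<and> (\<forall>x. f x = 0 \<longleftrightarrow> x = 0) \<and>
     (\<forall>c x. f (c *\<^sub>R x) = \<bar>c\<bar> * f x) \<and> (\<forall>x y. f (x + y) \<le> f x + f y)"

definition symmetrization :: "'a::real_vector set \<Rightarrow> 'a set" where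
  "symmetrization X = {(1/2) *\<^sub>R (x - y) | x y. x \<in> X \<and> y \<in> X}"

(* The order on real^'k is componentwise. *)
definition ellitope_data :: "('k::finite \<Rightarrow> real^'N^'N) \<Rightarrow> (real^'k) set \<Rightarrow> bool" where
  "ellitope_data T \<T> \<longleftrightarrow>
     (\<forall>k. psd (T k)) \<and> pd (\<Sum>k\<in>UNIV. T k) \<and>
     (\<forall>t\<in>\<T>. 0 \<le> t) \<and> convex \<T> \<and> compact \<T> \<and> interior \<T> \<noteq> {} \<and>
     (\<forall>t\<in>\<T>. \<forall>t'. 0 \<le> t' \<and> t' \<le> t \<longrightarrow> t' \<in> \<T>)"

definition ellitope ::
  "real^'N^'n \<Rightarrow> ('k::finite \<Rightarrow> real^'N^'N) \<Rightarrow> (real^'k) set \<Rightarrow> (real^'n) set" where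
  "ellitope P T \<T> = {x. \<exists>z. \<exists>t\<in>\<T>. x = P *v z \<and> (\<forall>k. z \<bullet> (T k *v z) \<le> t $ k)}"

(* The predicate is_ellitope says that a set is an ellitope for some data of unspecified sizes N
   and K.  Since a dimension that is a type cannot be quantified existentially, R^N and R^K are
   represented here by the functions nat => real vanishing from N (resp. K) on, with the product
   topology; it induces the usual topology on these finite-dimensional subspaces.  P is given by
   its columns. *)
definition coord_space :: "nat \<Rightarrow> (nat \<Rightarrow> real) set" where
  "coord_space K = {t. \<forall>k\<ge>K. t k = 0}"

definition quad_form :: "nat \<Rightarrow> (nat \<Rightarrow> nat \<Rightarrow> real) \<Rightarrow> (nat \<Rightarrow> real) \<Rightarrow> real" where
  "quad_form N M z = (\<Sum>i<N. \<Sum>j<N. z i * M i j * z j)"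

definition is_ellitope :: "(real^'n) set \<Rightarrow> bool" where
  "is_ellitope E \<longleftrightarrow>
     (\<exists>N K (P :: nat \<Rightarrow> real^'n) (T :: nat \<Rightarrow> nat \<Rightarrow> nat \<Rightarrow> real) \<T>.
        (\<forall>k<K. (\<forall>i<N. \<forall>j<N. T k i j = T k j i) \<and>
               (\<forall>z\<in>coord_space N. 0 \<le> quad_form N (T k) z)) \<and>
        (\<forall>z\<in>coord_space N. z \<noteq> (\<lambda>_. 0) \<longrightarrow> 0 < (\<Sum>k<K. quad_form N (T k) z)) \<and>
        \<T> \<subseteq> {t \<in> coord_space K. \<forall>k. 0 \<le> t k} \<and>
        (\<forall>s\<in>\<T>. \<forall>t\<in>\<T>. \<forall>u\<in>{0..1}. (\<lambda>k. (1 - u) * s k + u * t k) \<in> \<T>) \<and>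
        compact \<T> \<and>
        (top_of_set (coord_space K)) interior_of \<T> \<noteq> {} \<and>
        (\<forall>t\<in>\<T>. \<forall>t'\<in>coord_space K. (\<forall>k. 0 \<le> t' k \<and> t' k \<le> t k) \<longrightarrow> t' \<in> \<T>) \<and>
        E = {x. \<exists>z\<in>coord_space N. \<exists>t\<in>\<T>.
               x = (\<Sum>i<N. z i *\<^sub>R P i) \<and> (\<forall>k<K. quad_form N (T k) z \<le> t k)})"

(* The set R{w : Qw in Conv{+-v_1,...,+-v_J}}. *)
definition polytope_image ::
  "real^'q^'n \<Rightarrow> real^'q^'p \<Rightarrow> ('j::finite \<Rightarrow> real^'p) \<Rightarrow> (real^'n) set" where
  "polytope_image R Q v =
     {x. \<exists>w. x = R *v w \<and> Q *v w \<in> convex hull (range v \<union> range (\<lambda>j. - v j))}"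

definition admissible :: "(real^'m \<Rightarrow> real) \<Rightarrow> real^'c^'m \<Rightarrow> bool" where
  "admissible \<pi> H \<longleftrightarrow> (\<forall>j. \<pi> (column j H) \<le> 1)"

definition max_over :: "('a \<Rightarrow> real) \<Rightarrow> 'a set \<Rightarrow> real" where
  "max_over f D = (GREATEST r. r \<in> f ` D)"

definition risk ::
  "real^'n^'m \<Rightarrow> real^'n^'v \<Rightarrow> real \<Rightarrow> (real^'n) set \<Rightarrow> real^'c^'m \<Rightarrow> real" where
  "risk A B \<theta> Xs H =
     max_over (\<lambda>x. lp_norm (ereal \<theta>) (B *v x)) {x \<in> Xs. infnorm (transpose H *v (A *v x)) \<le> 1}"

definition quad_risk ::
  "real^'n^'m \<Rightarrow> real^'n^'n \<Rightarrow> (real^'n) set \<Rightarrow> real^'c^'m \<Rightarrow> real" where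
  "quad_risk A V \<Xi> G =
     max_over (\<lambda>x. x \<bullet> (V *v x)) {x \<in> \<Xi>. infnorm (transpose G *v (A *v x)) \<le> 1}"

end

theory Submission
  imports Defs
begin

text \<open>
  Evaluating the block form at \<open>x\<close> and \<open>y\<close> turns the matrix inequality into
  \<open>0 \<le> x \<bullet> ((U + S) x) + 2 y \<bullet> (B x) + (\<Sum>i. \<zeta>\<^sub>i y\<^sub>i\<^sup>2)\<close>. Minimizing over \<open>y\<close> (a Schur complement,
  \<open>quadratic_over_diag_le\<close>) bounds \<open>\<Sum>i. (B x)\<^sub>i\<^sup>2 / \<zeta>\<^sub>i\<close> by
  \<open>x \<bullet> ((U + S) x)\<close>. Since \<open>\<theta>/2\<close> and \<open>1 - \<theta>/2\<close> are complementary weights and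
  \<open>\<theta>\<^sub>* = (\<theta>/2) / (1 - \<theta>/2)\<close>, the Hoelder inequality shows that this weighted square sum dominates
  \<open>\<parallel>B x\<parallel>\<^sub>\<theta>\<^sup>2\<close> whenever \<open>\<parallel>\<zeta>\<parallel> \<le> 1\<close> in the \<open>\<theta>\<^sub>*\<close>-norm (\<open>lp_norm_square_le\<close>). Hence
  \<open>\<parallel>B x\<parallel>\<^sub>\<theta>\<^sup>2 \<le> x \<bullet> (U x) + x \<bullet> (S x)\<close> for every \<open>x\<close>.

  A point feasible for the contrast \<open>[H\<^sub>1, H\<^sub>2]\<close> is feasible for each of \<open>H\<^sub>1\<close> and \<open>H\<^sub>2\<close>, and the
  symmetrization lies in the ellitope, so the two quadratic terms are at most the two quadratic
  maxima. These maxima are attained because the symmetrization and the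
  ellitope are compact; for the ellitope this is where positive definiteness of
  \<open>\<Sum>k. T\<^sub>k\<close> enters, through coercivity (\<open>compact_ellitope\<close>). Attainment also gives the equality of
  the squared risk with the maximum of the squares (\<open>max_over_square\<close>).
\<close>

section \<open>Attained maxima\<close>

text \<open>Compactness is what makes the \<open>GREATEST\<close> in \<^const>\<open>max_over\<close> a genuine value.\<close>

lemma max_over_attained:
  fixes f :: "'a::topological_space \<Rightarrow> real"
  assumes "compact D" "D \<noteq> {}" "continuous_on D f"
  obtains x where "x \<in> D" "max_over f D = f x" "\<And>y. y \<in> D \<Longrightarrow> f y \<le> max_over f D"
proof -
  obtain x where x: "x \<in> D" "\<And>y. y \<in> D \<Longrightarrow> f y \<le> f x"
    using continuous_attains_sup[OF assms] by blast
  have "max_over f D = f x"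
    unfolding max_over_def by (rule Greatest_equality) (use x in auto)
  with x show thesis
    by (intro that) auto
qed

lemma max_over_upper:
  fixes f :: "'a::topological_space \<Rightarrow> real"
  assumes "compact D" "D \<noteq> {}" "continuous_on D f" "x \<in> D"
  shows "f x \<le> max_over f D"
  using assms by (metis max_over_attained)

lemma max_over_square:
  fixes f :: "'a::topological_space \<Rightarrow> real"
  assumes D: "compact D" "D \<noteq> {}" "continuous_on D f" and nonneg: "\<And>x. x \<in> D \<Longrightarrow> 0 \<le> f x"
  shows "(max_over f D)\<^sup>2 = max_over (\<lambda>x. (f x)\<^sup>2) D"
proof -
  obtain x where x: "x \<in> D" "max_over f D = f x" "\<And>y. y \<in> D \<Longrightarrow> f y \<le> max_over f D"
    using max_over_attained[OF D] by metis
  have "(f y)\<^sup>2 \<le> (f x)\<^sup>2" if "y \<in> D" for y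
    using x that nonneg by (intro power_mono) auto
  then have "max_over (\<lambda>x. (f x)\<^sup>2) D = (f x)\<^sup>2"
    unfolding max_over_def by (intro Greatest_equality) (use x(1) in auto)
  then show ?thesis
    using x(2) by simp
qed

lemma continuous_on_matrix_vector_mult [continuous_intros]:
  fixes M :: "real^'a^'b"
  assumes "continuous_on D f"
  shows "continuous_on D (\<lambda>x. M *v f x)"
  using bounded_linear.continuous_on[OF matrix_vector_mul_bounded_linear assms] .

lemma continuous_on_lp_norm:
  fixes f :: "'a::topological_space \<Rightarrow> real^'n"
  assumes "0 < p" "continuous_on D f"
  shows "continuous_on D (\<lambda>x. lp_norm (ereal p) (f x))"
proof -
  have "continuous_on D (\<lambda>x. \<bar>f x $ i\<bar> powr p)" for i
    using assms by (intro continuous_on_powr' continuous_intros) auto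
  then have "continuous_on D (\<lambda>x. \<Sum>i\<in>UNIV. \<bar>f x $ i\<bar> powr p)"
    by (intro continuous_on_sum)
  then have "continuous_on D (\<lambda>x. (\<Sum>i\<in>UNIV. \<bar>f x $ i\<bar> powr p) powr (1 / p))"
    using assms(1) by (intro continuous_on_powr' continuous_on_const) (auto intro: sum_nonneg)
  then show ?thesis
    by (simp add: lp_norm_def)
qed

lemma compact_feasible:
  fixes A :: "real^'n^'m" and H :: "real^'c^'m"
  assumes "compact E"
  shows "compact {x \<in> E. infnorm (transpose H *v (A *v x)) \<le> 1}"
proof -
  have "closed {x. infnorm (transpose H *v (A *v x)) \<le> 1}"
    by (intro closed_Collect_le continuous_intros)
  then have "compact (E \<inter> {x. infnorm (transpose H *v (A *v x)) \<le> 1})"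
    using assms by (rule compact_Int_closed[rotated])
  then show ?thesis
    by (simp add: Int_def)
qed

section \<open>Compactness of the symmetrization and of ellitopes\<close>

lemma compact_symmetrization:
  fixes X :: "'a::real_normed_vector set"
  assumes "compact X"
  shows "compact (symmetrization X)"
proof -
  have "symmetrization X = (\<lambda>(x, y). (1/2) *\<^sub>R (x - y)) ` (X \<times> X)"
    by (auto simp: symmetrization_def)
  moreover have "compact \<dots>"
    by (intro compact_continuous_image compact_Times assms)
       (auto simp: case_prod_unfold intro!: continuous_intros)
  ultimately show ?thesis
    by simp
qed

lemma zero_in_symmetrization:
  assumes "X \<noteq> {}"
  shows "0 \<in> symmetrization X"
  using assms by (force simp: symmetrization_def)

lemma inner_sum_matrix_vector_mult:
  fixes T :: "'k \<Rightarrow> real^'N^'N"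
  shows "z \<bullet> ((\<Sum>k\<in>I. T k) *v z) = (\<Sum>k\<in>I. z \<bullet> (T k *v z))"
  by (induction I rule: infinite_finite_induct)
     (auto simp: matrix_vector_mult_add_rdistrib inner_add_right)

text \<open>By homogeneity it suffices to bound the form below on the unit sphere, which is compact.\<close>

lemma pd_coercive:
  fixes M :: "real^'n^'n"
  assumes "pd M"
  obtains c where "0 < c" "\<And>z. c * (norm z)\<^sup>2 \<le> z \<bullet> (M *v z)"
proof -
  have "continuous_on (sphere 0 1) (\<lambda>z. z \<bullet> (M *v z))"
    by (intro continuous_intros)
  moreover have "sphere (0::real^'n) 1 \<noteq> {}"
    by simp
  ultimately obtain u where u: "u \<in> sphere 0 1"
      "\<And>z. z \<in> sphere 0 1 \<Longrightarrow> u \<bullet> (M *v u) \<le> z \<bullet> (M *v z)"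
    using continuous_attains_inf[OF compact_sphere] by blast
  have "u \<noteq> 0"
    using u(1) by auto
  then have pos: "0 < u \<bullet> (M *v u)"
    using assms by (simp add: pd_def)
  have "u \<bullet> (M *v u) * (norm z)\<^sup>2 \<le> z \<bullet> (M *v z)" for z
  proof (cases "z = 0")
    case False
    define w where "w = (1 / norm z) *\<^sub>R z"
    have z: "z = norm z *\<^sub>R w" and w: "w \<in> sphere 0 1"
      using False by (simp_all add: w_def)
    have "z \<bullet> (M *v z) = (norm z)\<^sup>2 * (w \<bullet> (M *v w))"
      by (subst (1 2) z) (simp add: matrix_vector_mult_scaleR power2_eq_square)
    also have "\<dots> \<ge> (norm z)\<^sup>2 * (u \<bullet> (M *v u))"
      using u(2)[OF w] by (intro mult_left_mono) auto
    finally show ?thesis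
      by (simp add: mult.commute)
  qed simp
  with pos show thesis
    by (rule that)
qed

text \<open>
  The ellitope is a linear image of the set of admissible pairs \<open>(z, t)\<close>. That set is closed, and
  summing the quadratic constraints over \<open>k\<close> bounds a coercive form of \<open>z\<close> by \<open>\<Sum>k. t\<^sub>k\<close>, which is
  bounded on the compact set \<open>\<T>\<close>.
\<close>

lemma compact_ellitope:
  fixes P :: "real^'N^'n" and T :: "'k::finite \<Rightarrow> real^'N^'N"
  assumes "ellitope_data T \<T>"
  shows "compact (ellitope P T \<T>)"
proof -
  have pd: "pd (\<Sum>k\<in>UNIV. T k)" and cT: "compact \<T>"
    using assms by (auto simp: ellitope_data_def)
  obtain c where c: "0 < c" "\<And>z. c * (norm z)\<^sup>2 \<le> z \<bullet> ((\<Sum>k\<in>UNIV. T k) *v z)"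
    using pd_coercive[OF pd] by blast
  obtain b where b: "\<And>t. t \<in> \<T> \<Longrightarrow> norm t \<le> b"
    using compact_imp_bounded[OF cT] by (auto simp: bounded_iff)
  define D where "D = {(z, t). t \<in> \<T> \<and> (\<forall>k. z \<bullet> (T k *v z) \<le> t $ k)}"
  have "norm z \<le> sqrt (real CARD('k) * b / c)" if "(z, t) \<in> D" for z t
  proof -
    have t: "t \<in> \<T>" "\<And>k. z \<bullet> (T k *v z) \<le> t $ k"
      using that by (auto simp: D_def)
    have "c * (norm z)\<^sup>2 \<le> (\<Sum>k\<in>UNIV. z \<bullet> (T k *v z))"
      using c(2)[of z] by (simp add: inner_sum_matrix_vector_mult)
    also have "\<dots> \<le> (\<Sum>k\<in>(UNIV::'k set). b)"
    proof (rule sum_mono)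
      fix k
      show "z \<bullet> (T k *v z) \<le> b"
        using t(2)[of k] component_le_norm_cart[of t k] b[OF t(1)] by linarith
    qed
    finally have "(norm z)\<^sup>2 \<le> real CARD('k) * b / c"
      using c(1) by (simp add: field_simps)
    then show ?thesis
      by (rule real_le_rsqrt)
  qed
  then have "D \<subseteq> cball 0 (sqrt (real CARD('k) * b / c)) \<times> \<T>"
    by (auto simp: D_def)
  moreover have "compact (cball (0::real^'N) (sqrt (real CARD('k) * b / c)) \<times> \<T>)"
    by (intro compact_Times compact_cball cT)
  moreover have "closed D"
  proof -
    have "D = (UNIV \<times> \<T>) \<inter> (\<Inter>k. {p. fst p \<bullet> (T k *v fst p) \<le> snd p $ k})"
      by (auto simp: D_def)
    moreover have "closed \<dots>"
      by (intro closed_Int closed_Times closed_UNIV compact_imp_closed[OF cT] closed_INT ballI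
          closed_Collect_le continuous_intros)
    ultimately show ?thesis
      by simp
  qed
  ultimately have "compact D"
    by (metis compact_Int_closed inf.absorb2)
  moreover have "ellitope P T \<T> = (\<lambda>p. P *v fst p) ` D"
    by (force simp: ellitope_def D_def)
  ultimately show ?thesis
    by (auto intro!: compact_continuous_image continuous_intros)
qed

section \<open>The Schur complement of a diagonal block\<close>

lemma psd_block_quadratic:
  fixes W :: "real^'n^'n" and B :: "real^'n^'v" and \<zeta> :: "real^'v"
  assumes "psd (block_matrix W (transpose B) B (Diag \<zeta>))"
  shows "0 \<le> x \<bullet> (W *v x) + 2 * (y \<bullet> (B *v x)) + (\<Sum>i\<in>UNIV. \<zeta> $ i * (y $ i)\<^sup>2)"
proof -
  define u :: "real^('n + 'v)" where "u = (\<chi> i. case i of Inl a \<Rightarrow> x $ a | Inr b \<Rightarrow> y $ b)"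
  have split: "(\<Sum>i\<in>UNIV. f i) = (\<Sum>a\<in>UNIV. f (Inl a)) + (\<Sum>b\<in>UNIV. f (Inr b))"
    for f :: "'n + 'v \<Rightarrow> real"
    using sum.Plus[of "UNIV :: 'n set" "UNIV :: 'v set" f] by (simp add: UNIV_Plus_UNIV comp_def)
  have diag: "Diag \<zeta> *v y = (\<chi> i. \<zeta> $ i * y $ i)"
    by (simp add: vec_eq_iff Diag_def matrix_vector_mult_def if_distrib if_distribR cong: if_cong)
  have "u \<bullet> (block_matrix W (transpose B) B (Diag \<zeta>) *v u)
      = x \<bullet> (W *v x) + x \<bullet> (transpose B *v y) + (y \<bullet> (B *v x) + y \<bullet> (Diag \<zeta> *v y))"
    unfolding inner_vec_def matrix_vector_mult_def block_matrix_def u_def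
    by (simp add: split algebra_simps sum.distrib)
  also have "x \<bullet> (transpose B *v y) = y \<bullet> (B *v x)"
    by (metis dot_lmul_matrix inner_commute transpose_matrix_vector)
  also have "y \<bullet> (Diag \<zeta> *v y) = (\<Sum>i\<in>UNIV. \<zeta> $ i * (y $ i)\<^sup>2)"
    by (simp add: diag inner_vec_def power2_eq_square algebra_simps)
  finally show ?thesis
    using assms unfolding psd_def by (metis (no_types, lifting) add.assoc mult_2)
qed

lemma sum_axis_square:
  fixes \<zeta> :: "real^'v"
  shows "(\<Sum>j\<in>UNIV. \<zeta> $ j * ((s *\<^sub>R axis i 1 :: real^'v) $ j)\<^sup>2) = \<zeta> $ i * s\<^sup>2"
proof -
  have "(\<Sum>j\<in>UNIV. \<zeta> $ j * ((s *\<^sub>R axis i 1 :: real^'v) $ j)\<^sup>2)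
      = (\<Sum>j\<in>UNIV. if j = i then \<zeta> $ i * s\<^sup>2 else 0)"
    by (intro sum.cong) (auto simp: axis_def)
  then show ?thesis
    by simp
qed

lemma psd_block_diag_nonneg:
  fixes W :: "real^'n^'n" and B :: "real^'n^'v" and \<zeta> :: "real^'v"
  assumes "psd (block_matrix W (transpose B) B (Diag \<zeta>))"
  shows "0 \<le> \<zeta> $ i"
  using psd_block_quadratic[OF assms, of 0 "1 *\<^sub>R axis i 1"] sum_axis_square[of \<zeta> 1 i] by simp

text \<open>A zero on the diagonal leaves a form that is affine in the corresponding coordinate of \<open>y\<close>,
  and an affine function that is bounded below is constant.\<close>

lemma psd_block_diag_zero:
  fixes W :: "real^'n^'n" and B :: "real^'n^'v" and \<zeta> :: "real^'v"
  assumes "psd (block_matrix W (transpose B) B (Diag \<zeta>))" and "\<zeta> $ i = 0"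
  shows "(B *v x) $ i = 0"
proof (rule ccontr)
  assume nz: "(B *v x) $ i \<noteq> 0"
  define s where "s = - (x \<bullet> (W *v x) + 1) / (2 * (B *v x) $ i)"
  \<comment> \<open>The value \<open>s\<close> of the free coordinate is chosen to make the form equal to \<open>-1\<close>.\<close>
  have "0 \<le> x \<bullet> (W *v x) + 2 * (s * (B *v x) $ i)"
    using psd_block_quadratic[OF assms(1), of x "s *\<^sub>R axis i 1"] sum_axis_square[of \<zeta> s i] assms(2)
    by (simp add: inner_axis')
  also have "2 * (s * (B *v x) $ i) = - (x \<bullet> (W *v x) + 1)"
    using nz by (simp add: s_def field_simps)
  finally show False
    by simp
qed

text \<open>The minimizer over \<open>y\<close> is \<open>y\<^sub>i = - (B x)\<^sub>i / \<zeta>\<^sub>i\<close>. Where \<open>\<zeta>\<^sub>i = 0\<close>, division by zero removes the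
  coordinate from both sums, which loses nothing because \<open>(B x)\<^sub>i = 0\<close> there
  (\<open>psd_block_diag_zero\<close>).\<close>

lemma quadratic_over_diag_le:
  fixes W :: "real^'n^'n" and B :: "real^'n^'v" and \<zeta> :: "real^'v"
  assumes "psd (block_matrix W (transpose B) B (Diag \<zeta>))"
  shows "(\<Sum>i\<in>UNIV. ((B *v x) $ i)\<^sup>2 / \<zeta> $ i) \<le> x \<bullet> (W *v x)"
proof -
  define q where "q = (\<Sum>i\<in>UNIV. ((B *v x) $ i)\<^sup>2 / \<zeta> $ i)"
  define y :: "real^'v" where "y = (\<chi> i. - (B *v x) $ i / \<zeta> $ i)"
  have "y \<bullet> (B *v x) = - q"
    by (simp add: y_def q_def inner_vec_def power2_eq_square sum_negf)
  moreover have "(\<Sum>i\<in>UNIV. \<zeta> $ i * (y $ i)\<^sup>2) = q"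
    unfolding q_def by (intro sum.cong) (auto simp: y_def power2_eq_square)
  ultimately have "0 \<le> x \<bullet> (W *v x) + 2 * (- q) + q"
    using psd_block_quadratic[OF assms, of x y] by simp
  then show ?thesis
    by (simp add: q_def)
qed

section \<open>A weighted Hoelder bound\<close>

lemma lp_norm_nonneg: "0 \<le> lp_norm (ereal p) x"
  by (simp add: lp_norm_def)

text \<open>
  With \<open>s = \<Sum>i. y\<^sub>i\<^sup>2 / \<zeta>\<^sub>i\<close>, each \<open>\<bar>y\<^sub>i\<bar>\<^sup>\<theta> / s\<^bsup>\<theta>/2\<^esup>\<close> is the weighted geometric mean of
  \<open>y\<^sub>i\<^sup>2 / (\<zeta>\<^sub>i s)\<close> and \<open>\<zeta>\<^sub>i\<close> raised to \<open>\<theta>\<^sub>*\<close>, with weights \<open>\<theta>/2\<close> and \<open>1 - \<theta>/2\<close>. Both families sum to at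
  most \<open>1\<close>, so bounding the geometric by the arithmetic mean and summing gives the claim. For \<open>\<theta> = 2\<close> the
  exponent \<open>\<theta>\<^sub>*\<close> is infinite, and \<open>\<zeta>\<^sub>i \<le> 1\<close> gives the claim term by term.
\<close>

lemma lp_norm_square_le:
  fixes y \<zeta> :: "real^'v"
  assumes \<theta>: "1 \<le> \<theta>" "\<theta> \<le> 2"
    and \<zeta>: "\<And>i. 0 \<le> \<zeta> $ i" "lp_norm (theta_star \<theta>) \<zeta> \<le> 1"
    and zero: "\<And>i. \<zeta> $ i = 0 \<Longrightarrow> y $ i = 0"
  shows "(lp_norm (ereal \<theta>) y)\<^sup>2 \<le> (\<Sum>i\<in>UNIV. (y $ i)\<^sup>2 / \<zeta> $ i)"
proof -
  define s where "s = (\<Sum>i\<in>UNIV. (y $ i)\<^sup>2 / \<zeta> $ i)"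
  have s0: "0 \<le> s"
    unfolding s_def using \<zeta>(1) by (intro sum_nonneg) auto
  have power_sum: "(\<Sum>i\<in>UNIV. \<bar>y $ i\<bar> powr \<theta>) \<le> s powr (\<theta>/2)"
  proof (cases "\<theta> = 2")
    case True
    have "(y $ i)\<^sup>2 \<le> (y $ i)\<^sup>2 / \<zeta> $ i" for i
    proof (cases "\<zeta> $ i = 0")
      case False
      have "\<zeta> $ i \<le> 1"
        using \<zeta>(2) True component_le_infnorm_cart[of \<zeta> i] by (simp add: lp_norm_def theta_star_def)
      then have "(y $ i)\<^sup>2 * \<zeta> $ i \<le> (y $ i)\<^sup>2"
        using \<zeta>(1)[of i] by (simp add: mult_left_le)
      then show ?thesis
        using False \<zeta>(1)[of i] by (simp add: field_simps)
    qed (simp add: zero)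
    then have "(\<Sum>i\<in>UNIV. (y $ i)\<^sup>2) \<le> s"
      unfolding s_def by (rule sum_mono)
    then show ?thesis
      using True s0 by simp
  next
    case False
    then have lt: "\<theta> < 2"
      using \<theta> by simp
    define p where "p = \<theta> / (2 - \<theta>)"
    have p: "0 < p" "p * (1 - \<theta>/2) = \<theta>/2"
      using \<theta> lt by (simp_all add: p_def field_simps)
    define r where "r = (\<Sum>i\<in>UNIV. \<zeta> $ i powr p)"
    have "r powr (1/p) \<le> 1"
      using \<zeta> False by (simp add: lp_norm_def theta_star_def r_def p_def)
    then have r1: "r \<le> 1"
      using gr_one_powr[of r "1/p"] p(1) by fastforce
    show ?thesis
    proof (cases "s = 0")
      case True
      then have "(y $ i)\<^sup>2 / \<zeta> $ i = 0" for i
        using \<zeta>(1) by (simp add: s_def sum_nonneg_eq_0_iff)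
      then have "y $ i = 0" for i
        using zero[of i] by auto
      then show ?thesis
        by simp
    next
      case False
      then have s: "0 < s"
        using s0 by simp
      have term_le: "\<bar>y $ i\<bar> powr \<theta> \<le>
          s powr (\<theta>/2) * (\<theta>/2 * ((y $ i)\<^sup>2 / \<zeta> $ i / s) + (1 - \<theta>/2) * \<zeta> $ i powr p)" for i
      proof (cases "y $ i = 0")
        case True
        then show ?thesis
          using lt by simp
      next
        case False
        then have z: "0 < \<zeta> $ i"
          using \<zeta>(1)[of i] zero[of i] by (metis less_eq_real_def)
        define a where "a = (y $ i)\<^sup>2 / \<zeta> $ i / s"
        have a: "0 < a"
          using z s False by (simp add: a_def)
        have "(y $ i)\<^sup>2 = s * (a * \<zeta> $ i)"
          using z s by (simp add: a_def)
        then have "((y $ i)\<^sup>2) powr (\<theta>/2) = s powr (\<theta>/2) * (a powr (\<theta>/2) * \<zeta> $ i powr (\<theta>/2))"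
          using z s a by (simp add: powr_mult)
        moreover have "((y $ i)\<^sup>2) powr (\<theta>/2) = \<bar>y $ i\<bar> powr \<theta>"
        proof -
          have "(y $ i)\<^sup>2 = \<bar>y $ i\<bar> powr 2"
            using False by simp
          then show ?thesis
            by (simp only: powr_powr) simp
        qed
        moreover have "\<zeta> $ i powr (\<theta>/2) = (\<zeta> $ i powr p) powr (1 - \<theta>/2)"
          by (simp add: powr_powr p(2))
        ultimately have eq: "\<bar>y $ i\<bar> powr \<theta> =
            s powr (\<theta>/2) * (a powr (\<theta>/2) * (\<zeta> $ i powr p) powr (1 - \<theta>/2))"
          by simp
        have "a powr (\<theta>/2) * (\<zeta> $ i powr p) powr (1 - \<theta>/2)
            \<le> \<theta>/2 * a + (1 - \<theta>/2) * \<zeta> $ i powr p"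
          using \<theta> a z by (intro Youngs_inequality_0) auto
        then show ?thesis
          unfolding eq a_def by (intro mult_left_mono) auto
      qed
      have ratio_sum: "(\<Sum>i\<in>UNIV. (y $ i)\<^sup>2 / \<zeta> $ i / s) = s / s"
        unfolding sum_divide_distrib[symmetric] s_def[symmetric] ..
      have "(\<Sum>i\<in>UNIV. \<bar>y $ i\<bar> powr \<theta>) \<le> (\<Sum>i\<in>UNIV.
          s powr (\<theta>/2) * (\<theta>/2 * ((y $ i)\<^sup>2 / \<zeta> $ i / s) + (1 - \<theta>/2) * \<zeta> $ i powr p))"
        by (intro sum_mono term_le)
      also have "\<dots> = s powr (\<theta>/2) * (\<theta>/2 * (s / s) + (1 - \<theta>/2) * r)"
        by (simp only: ratio_sum[symmetric] r_def sum_distrib_left sum.distrib distrib_left)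
      also have "\<dots> \<le> s powr (\<theta>/2) * 1"
      proof (rule mult_left_mono)
        have "(1 - \<theta>/2) * r \<le> (1 - \<theta>/2) * 1"
          using r1 lt by (intro mult_left_mono) auto
        then show "\<theta>/2 * (s / s) + (1 - \<theta>/2) * r \<le> 1"
          using s by simp
      qed simp
      finally show ?thesis
        by simp
    qed
  qed
  have "lp_norm (ereal \<theta>) y \<le> (s powr (\<theta>/2)) powr (1/\<theta>)"
    unfolding lp_norm_def using power_sum \<theta>
    by (auto intro!: powr_mono2 sum_nonneg)
  also have "\<dots> = sqrt s"
    using \<theta> s0 by (simp add: powr_powr powr_half_sqrt)
  finally have "(lp_norm (ereal \<theta>) y)\<^sup>2 \<le> (sqrt s)\<^sup>2"
    using lp_norm_nonneg by (intro power_mono)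
  then show ?thesis
    using s0 by (simp add: s_def)
qed

section \<open>Splitting the risk of a concatenated contrast\<close>

lemma infnorm_le_iff:
  fixes x :: "real^'n"
  shows "infnorm x \<le> a \<longleftrightarrow> (\<forall>i. \<bar>x $ i\<bar> \<le> a)"
proof
  show "infnorm x \<le> a \<Longrightarrow> \<forall>i. \<bar>x $ i\<bar> \<le> a"
    using component_le_infnorm_cart order_trans by blast
  show "\<forall>i. \<bar>x $ i\<bar> \<le> a \<Longrightarrow> infnorm x \<le> a"
    unfolding infnorm_cart by (rule cSup_least) auto
qed

lemma infnorm_hcat_le_iff:
  fixes G :: "real^'a^'m" and H :: "real^'b^'m"
  shows "infnorm (transpose (hcat G H) *v w) \<le> a \<longleftrightarrow>
    infnorm (transpose G *v w) \<le> a \<and> infnorm (transpose H *v w) \<le> a"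
proof -
  have "(transpose (hcat G H) *v w) $ Inl i = (transpose G *v w) $ i"
    and "(transpose (hcat G H) *v w) $ Inr j = (transpose H *v w) $ j" for i j
    unfolding matrix_vector_mult_def transpose_def hcat_def by simp_all
  then show ?thesis
    by (simp only: infnorm_le_iff split_sum_all)
qed

theorem mainTheorem2:
  fixes A :: "real^'n^'m" and B :: "real^'n^'v"
    and X :: "(real^'n) set"
    and P :: "real^'N^'n" and T :: "'k::finite \<Rightarrow> real^'N^'N" and \<T> :: "(real^'k) set"
    and R :: "real^'q^'n" and Q :: "real^'q^'p" and v :: "'j::finite \<Rightarrow> real^'p"
    and \<pi> :: "real \<Rightarrow> real^'m \<Rightarrow> real"
    and noise :: "real^'n \<Rightarrow> (real^'m) measure"
    and \<theta> \<delta> :: real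
    and \<zeta> :: "real^'v" and U S :: "real^'n^'n"
    and H1 :: "real^'c1^'m" and H2 :: "real^'c2^'m"
  assumes X: "X \<noteq> {}" "convex X" "compact X"
    and ellitope: "ellitope_data T \<T>"
    and kernel: "\<forall>w. Q *v w = 0 \<longrightarrow> w = 0"
    and Xs: "symmetrization X \<subseteq> ellitope P T \<T> \<inter> polytope_image R Q v"
    and noise: "\<And>x. x \<in> X \<Longrightarrow> prob_space (noise x)"
      "\<And>x. x \<in> X \<Longrightarrow> sets (noise x) = sets borel"
    and norm: "\<And>d. 0 < d \<Longrightarrow> is_norm (\<pi> d)"
      "\<And>d. 0 < d \<Longrightarrow> is_ellitope {h. \<pi> d h \<le> 1}"
    and prob: "\<And>d h x. 0 < d \<Longrightarrow> \<pi> d h \<le> 1 \<Longrightarrow> x \<in> X \<Longrightarrow>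
      measure (noise x) {\<xi>. \<bar>h \<bullet> \<xi>\<bar> > 1} \<le> d"
    and \<theta>: "1 \<le> \<theta>" "\<theta> \<le> 2" and \<delta>: "0 < \<delta>"
    and US: "symmetric U" "symmetric S"
    and lmi: "psd (block_matrix (U + S) (transpose B) B (Diag \<zeta>))"
    and \<zeta>: "lp_norm (theta_star \<theta>) \<zeta> \<le> 1"
    and H: "admissible (\<pi> \<delta>) H1" "admissible (\<pi> \<delta>) H2"
  shows "(risk A B \<theta> (symmetrization X) (hcat H1 H2))\<^sup>2 =
           max_over (\<lambda>x. (lp_norm (ereal \<theta>) (B *v x))\<^sup>2)
             {x \<in> symmetrization X. infnorm (transpose (hcat H1 H2) *v (A *v x)) \<le> 1}
       \<and> max_over (\<lambda>x. (lp_norm (ereal \<theta>) (B *v x))\<^sup>2)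
             {x \<in> symmetrization X. infnorm (transpose (hcat H1 H2) *v (A *v x)) \<le> 1}
         \<le> quad_risk A U (ellitope P T \<T>) H1 + quad_risk A S (symmetrization X) H2"
proof
  let ?f = "\<lambda>x. lp_norm (ereal \<theta>) (B *v x)"
  let ?Xs = "symmetrization X"
  let ?E = "ellitope P T \<T>"
  let ?D = "{x \<in> ?Xs. infnorm (transpose (hcat H1 H2) *v (A *v x)) \<le> 1}"
  let ?D1 = "{x \<in> ?E. infnorm (transpose H1 *v (A *v x)) \<le> 1}"
  let ?D2 = "{x \<in> ?Xs. infnorm (transpose H2 *v (A *v x)) \<le> 1}"
  have compact: "compact ?D" "compact ?D1" "compact ?D2"
    by (intro compact_feasible compact_symmetrization compact_ellitope X ellitope)+
  have zero: "0 \<in> ?D"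
    using zero_in_symmetrization[OF X(1)] by (simp add: infnorm_0)
  have sub1: "?D \<subseteq> ?D1"
    using Xs unfolding infnorm_hcat_le_iff by blast
  have sub2: "?D \<subseteq> ?D2"
    unfolding infnorm_hcat_le_iff by blast
  have nonempty: "?D \<noteq> {}" "?D1 \<noteq> {}" "?D2 \<noteq> {}"
    using zero sub1 sub2 by blast+
  have cont: "continuous_on ?D ?f"
    using \<theta> by (intro continuous_on_lp_norm continuous_intros) auto
  show "(risk A B \<theta> ?Xs (hcat H1 H2))\<^sup>2 = max_over (\<lambda>x. (?f x)\<^sup>2) ?D"
    unfolding risk_def by (rule max_over_square[OF compact(1) nonempty(1) cont lp_norm_nonneg])
  have pointwise: "(?f x)\<^sup>2 \<le> x \<bullet> (U *v x) + x \<bullet> (S *v x)" for x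
  proof -
    have "(?f x)\<^sup>2 \<le> (\<Sum>i\<in>UNIV. ((B *v x) $ i)\<^sup>2 / \<zeta> $ i)"
      by (rule lp_norm_square_le[OF \<theta> psd_block_diag_nonneg[OF lmi] \<zeta> psd_block_diag_zero[OF lmi]])
    also have "\<dots> \<le> x \<bullet> ((U + S) *v x)"
      by (rule quadratic_over_diag_le[OF lmi])
    finally show ?thesis
      by (simp add: matrix_vector_mult_add_rdistrib inner_add_right)
  qed
  have cont_sq: "continuous_on ?D (\<lambda>x. (?f x)\<^sup>2)"
    by (intro continuous_on_power cont)
  obtain x where x: "x \<in> ?D" "max_over (\<lambda>x. (?f x)\<^sup>2) ?D = (?f x)\<^sup>2"
    by (rule max_over_attained[OF compact(1) nonempty(1) cont_sq]) (rule that)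
  have quad: "continuous_on D (\<lambda>x. x \<bullet> (V *v x))" for D and V :: "real^'n^'n"
    by (intro continuous_intros)
  have "x \<bullet> (U *v x) \<le> quad_risk A U ?E H1"
    unfolding quad_risk_def
    by (rule max_over_upper[OF compact(2) nonempty(2) quad subsetD[OF sub1 x(1)]])
  moreover have "x \<bullet> (S *v x) \<le> quad_risk A S ?Xs H2"
    unfolding quad_risk_def
    by (rule max_over_upper[OF compact(3) nonempty(3) quad subsetD[OF sub2 x(1)]])
  ultimately show "max_over (\<lambda>x. (?f x)\<^sup>2) ?D \<le> quad_risk A U ?E H1 + quad_risk A S ?Xs H2"
    using pointwise[of x] x(2) by linarith
qed

end
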